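(* Let $\mathcal{P}$ be a consistent path system on a finite vertex set $V$. Then: (1) $\mathcal{P}$ is strictly metric if and only if $T(\mathcal{P})=T(\rho)$ for some metric $\rho$ on $V$. (2) $\mathcal{P}$ is metric if and only if $T(\mathcal{P})\subseteq T(\rho)$ for some metric $\rho$ on $V$.
   Context: A consistent path system on a finite set $V$ is a collection $\mathcal{P}$ of simple paths in the complete graph on $V$ such that: (i) for every pair of distinct $u,v\in V$ there is exactly one path in $\mathcal{P}$ with end vertices $u,v$, denoted $P_{u,v}=P_{v,u}$; (ii) the non-empty intersection of any two paths in $\mathcal{P}$ is either a single vertex or a path in $\mathcal{P}$. It is metric (resp. strictly metric) if there is a function $w:\binom{V}{2}\to\mathbb{R}_{>0}$ on the edges such that each path in $\mathcal{P}$ is a $w$-shortest path (resp. the unique $w$-shortest path) between its end vertices. A pointed triple $\{a,b;c\}$, with $a,b,c\in V$ distinct, is the set $\{a,b,c\}$ with the element $c$ distinguished from $a,b$ (so $\{a,b;c\}=\{b,a;c\}$). $\binom{V}{3}^{\ast}$ is the set of all pointed triples over $V$. For a metric $\rho$ on $V$, $T(\rho)=\{\{a,b;c\}\in\binom{V}{3}^\ast : \rho(a,b)=\rho(a,c)+\rho(c,b)\}$. For a consistent path system, $T(\mathcal{P})=\{\{a,b;c\}\in\binom{V}{3}^\ast : c\in P_{a,b}\}$, where $c\in P_{a,b}$ means $c$ is a vertex of $P_{a,b}$. *)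

theory Defs
  imports "HOL-Analysis.Abstract_Metric_Spaces"
begin

text \<open>
  A path in the complete graph on \<open>V\<close> is an undirected subgraph, given by its vertex set and its
  set of two-element edges; thus a path and its reversal are the same object.
\<close>

type_synonym 'a path = "'a set \<times> 'a set set"

abbreviation verts :: "'a path \<Rightarrow> 'a set" where "verts \<equiv> fst"
abbreviation edges :: "'a path \<Rightarrow> 'a set set" where "edges \<equiv> snd"

definition path_of_list :: "'a list \<Rightarrow> 'a path" where
  "path_of_list xs = (set xs, {{xs ! i, xs ! Suc i} | i. Suc i < length xs})"

text \<open>The relation is symmetric in the two end vertices \<open>u\<close>, \<open>v\<close>.\<close>

definition simple_path_between :: "'a set \<Rightarrow> 'a \<Rightarrow> 'a \<Rightarrow> 'a path \<Rightarrow> bool" where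
  "simple_path_between V u v p \<longleftrightarrow>
     (\<exists>xs. xs \<noteq> [] \<and> distinct xs \<and> set xs \<subseteq> V \<and> hd xs = u \<and> last xs = v \<and> p = path_of_list xs)"

definition path_inter :: "'a path \<Rightarrow> 'a path \<Rightarrow> 'a path" where
  "path_inter p q = (verts p \<inter> verts q, edges p \<inter> edges q)"

text \<open>One-vertex paths may, but need not, belong to the system.\<close>

definition consistent_path_system :: "'a set \<Rightarrow> 'a path set \<Rightarrow> bool" where
  "consistent_path_system V P \<longleftrightarrow>
     (\<forall>p\<in>P. \<exists>u v. simple_path_between V u v p) \<and>
     (\<forall>u\<in>V. \<forall>v\<in>V. u \<noteq> v \<longrightarrow> (\<exists>!p. p \<in> P \<and> simple_path_between V u v p)) \<and>
     (\<forall>p\<in>P. \<forall>q\<in>P. verts p \<inter> verts q \<noteq> {} \<longrightarrow>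
        (\<exists>v. path_inter p q = ({v}, {})) \<or> path_inter p q \<in> P)"

definition the_path :: "'a set \<Rightarrow> 'a path set \<Rightarrow> 'a \<Rightarrow> 'a \<Rightarrow> 'a path" where
  "the_path V P u v = (THE p. p \<in> P \<and> simple_path_between V u v p)"

definition positive_weight :: "'a set \<Rightarrow> ('a set \<Rightarrow> real) \<Rightarrow> bool" where
  "positive_weight V w \<longleftrightarrow> (\<forall>e. e \<subseteq> V \<and> card e = 2 \<longrightarrow> w e > 0)"

definition path_weight :: "('a set \<Rightarrow> real) \<Rightarrow> 'a path \<Rightarrow> real" where
  "path_weight w p = (\<Sum>e\<in>edges p. w e)"

definition shortest_path :: "'a set \<Rightarrow> ('a set \<Rightarrow> real) \<Rightarrow> 'a \<Rightarrow> 'a \<Rightarrow> 'a path \<Rightarrow> bool" where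
  "shortest_path V w u v p \<longleftrightarrow> simple_path_between V u v p \<and>
     (\<forall>q. simple_path_between V u v q \<longrightarrow> path_weight w p \<le> path_weight w q)"

definition unique_shortest_path :: "'a set \<Rightarrow> ('a set \<Rightarrow> real) \<Rightarrow> 'a \<Rightarrow> 'a \<Rightarrow> 'a path \<Rightarrow> bool" where
  "unique_shortest_path V w u v p \<longleftrightarrow> shortest_path V w u v p \<and>
     (\<forall>q. shortest_path V w u v q \<longrightarrow> q = p)"

definition metric_path_system :: "'a set \<Rightarrow> 'a path set \<Rightarrow> bool" where
  "metric_path_system V P \<longleftrightarrow>
     (\<exists>w. positive_weight V w \<and>
        (\<forall>p\<in>P. \<forall>u v. simple_path_between V u v p \<longrightarrow> shortest_path V w u v p))"

definition strictly_metric_path_system :: "'a set \<Rightarrow> 'a path set \<Rightarrow> bool" where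
  "strictly_metric_path_system V P \<longleftrightarrow>
     (\<exists>w. positive_weight V w \<and>
        (\<forall>p\<in>P. \<forall>u v. simple_path_between V u v p \<longrightarrow> unique_shortest_path V w u v p))"

text \<open>The pointed triple \<open>{a,b;c}\<close> is encoded as the pair \<open>({a,b}, c)\<close>.\<close>

definition pointed_triples :: "'a set \<Rightarrow> ('a set \<times> 'a) set" where
  "pointed_triples V =
     {({a, b}, c) | a b c. a \<in> V \<and> b \<in> V \<and> c \<in> V \<and> a \<noteq> b \<and> a \<noteq> c \<and> b \<noteq> c}"

definition metric_triples :: "'a set \<Rightarrow> ('a \<Rightarrow> 'a \<Rightarrow> real) \<Rightarrow> ('a set \<times> 'a) set" where
  "metric_triples V \<rho> =
     {({a, b}, c) | a b c. ({a, b}, c) \<in> pointed_triples V \<and> \<rho> a b = \<rho> a c + \<rho> c b}"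

definition path_triples :: "'a set \<Rightarrow> 'a path set \<Rightarrow> ('a set \<times> 'a) set" where
  "path_triples V P =
     {({a, b}, c) | a b c. ({a, b}, c) \<in> pointed_triples V \<and> c \<in> verts (the_path V P a b)}"

end

theory Submission
  imports Defs
begin

text \<open>
  From a weight \<open>w\<close> to a metric, let \<open>\<rho> u v\<close> be the weight of \<open>P\<^bsub>u,v\<^esub>\<close>. Since this path is shortest,
  no walk from \<open>u\<close> to \<open>v\<close> weighs less than \<open>\<rho> u v\<close>. This gives the triangle inequality, and, by
  splitting \<open>P\<^bsub>a,b\<^esub>\<close> at one of its vertices \<open>c\<close>, it gives \<open>\<rho> a b = \<rho> a c + \<rho> c b\<close>. If shortest paths
  are unique and that equation holds for some \<open>c\<close>, then the walk from \<open>a\<close> along \<open>P\<^bsub>a,c\<^esub>\<close> and \<open>P\<^bsub>c,b\<^esub>\<close>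
  has minimal weight; a walk that repeats a vertex can be strictly shortened
  (\<open>walk_contains_path\<close>), so this one is simple and equals \<open>P\<^bsub>a,b\<^esub>\<close>.

  From a metric \<open>\<rho>\<close> to a weight, give each edge its \<open>\<rho>\<close>-length, plus 1 if no path of the system uses
  it. Every path from \<open>u\<close> to \<open>v\<close> then weighs at least \<open>\<rho> u v\<close>. By consistency, a path \<open>x\<^sub>0, \<dots>, x\<^sub>k\<close> of
  the system has \<open>x\<^sub>i\<^sub>+\<^sub>1\<close> on the path from \<open>x\<^sub>i\<close> to \<open>x\<^sub>k\<close> (\<open>segment_edge_in_the_path\<close>), so the hypothesis
  on triples splits \<open>\<rho> x\<^sub>i x\<^sub>k\<close> at \<open>x\<^sub>i\<^sub>+\<^sub>1\<close>; summing over \<open>i\<close>, the path weighs exactly \<open>\<rho> x\<^sub>0 x\<^sub>k\<close>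
  (\<open>walk_length_system_path\<close>). If moreover the triples coincide, a competing shortest path is
  geodesic for \<open>\<rho>\<close> and uses only edges of the system. No point lies metrically strictly inside
  such an edge, whereas the path of the system contains every point between its ends; these two
  properties force the paths to agree (\<open>geodesics_eq\<close>).
\<close>

section \<open>Lists as walks\<close>

fun walk_length :: "('a \<Rightarrow> 'a \<Rightarrow> real) \<Rightarrow> 'a list \<Rightarrow> real" where
  "walk_length d (x # y # zs) = d x y + walk_length d (y # zs)"
| "walk_length d _ = 0"

lemma walk_length_append:
  "walk_length d (xs @ y # zs) = walk_length d (xs @ [y]) + walk_length d (y # zs)"
  by (induction xs rule: induct_list012) simp_all

lemma verts_path_of_list [simp]: "verts (path_of_list xs) = set xs"
  by (simp add: path_of_list_def)

lemma edge_path_of_list_nth: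
  "Suc i < length xs \<Longrightarrow> {xs ! i, xs ! Suc i} \<in> edges (path_of_list xs)"
  by (auto simp: path_of_list_def)

lemma edges_path_of_list_Cons_Cons:
  "edges (path_of_list (x # y # zs)) = insert {x, y} (edges (path_of_list (y # zs)))"
proof -
  have "{i. Suc i < length (x # y # zs)} = insert 0 (Suc ` {i. Suc i < length (y # zs)})"
    by (auto simp: image_iff less_Suc_eq_0_disj)
  then show ?thesis
    unfolding path_of_list_def setcompr_eq_image by (simp add: image_image)
qed

lemma edges_path_of_list_short [simp]:
  "edges (path_of_list []) = {}" "edges (path_of_list [x]) = {}"
  by (auto simp: path_of_list_def)

lemma edges_path_of_list_subset: "e \<in> edges (path_of_list xs) \<Longrightarrow> e \<subseteq> set xs"
  by (auto simp: path_of_list_def)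

lemma finite_edges_path_of_list: "finite (edges (path_of_list xs))"
  by (rule finite_subset[of _ "Pow (set xs)"]) (auto dest: edges_path_of_list_subset)

lemma path_of_list_rev: "path_of_list (rev xs) = path_of_list xs"
proof -
  have sub: "edges (path_of_list ys) \<subseteq> edges (path_of_list (rev ys))" for ys :: "'a list"
  proof
    fix e assume "e \<in> edges (path_of_list ys)"
    then obtain i where i: "Suc i < length ys" and e: "e = {ys ! i, ys ! Suc i}"
      by (auto simp: path_of_list_def)
    define j where "j = length ys - Suc (Suc i)"
    have j: "Suc j < length (rev ys)" "length ys - Suc j = Suc i" "length ys - Suc (Suc j) = i"
      using i by (auto simp: j_def)
    then have "rev ys ! j = ys ! Suc i" "rev ys ! Suc j = ys ! i"
      by (auto simp: rev_nth)
    then show "e \<in> edges (path_of_list (rev ys))"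
      using edge_path_of_list_nth[OF j(1)] e by (simp add: insert_commute)
  qed
  show ?thesis
    using sub[of xs] sub[of "rev xs"] by (auto simp: prod_eq_iff)
qed

text \<open>Distinctness matters: a repeated edge would be counted once on the left.\<close>

lemma path_weight_path_of_list:
  "distinct xs \<Longrightarrow> path_weight w (path_of_list xs) = walk_length (\<lambda>x y. w {x, y}) xs"
proof (induction xs rule: induct_list012)
  case (3 x y zs)
  have "{x, y} \<notin> edges (path_of_list (y # zs))"
    using 3(3) edges_path_of_list_subset[of "{x, y}" "y # zs"] by auto
  then show ?case
    using 3 by (simp add: path_weight_def edges_path_of_list_Cons_Cons finite_edges_path_of_list)
qed (auto simp: path_weight_def)

lemma distinct_imp_distinct_adj: "distinct xs \<Longrightarrow> distinct_adj xs"
  by (auto simp: distinct_adj_conv_nth nth_eq_iff_index_eq)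

lemma walk_length_nonneg:
  assumes "distinct_adj xs" "set xs \<subseteq> V" "positive_weight V w"
  shows "0 \<le> walk_length (\<lambda>x y. w {x, y}) xs"
  using assms
proof (induction xs rule: induct_list012)
  case (3 x y zs)
  then have "0 < w {x, y}"
    by (auto simp: positive_weight_def)
  then show ?case using 3 by auto
qed auto

text \<open>
  Cutting the cycles out of a walk yields a simple path, and each cut is a strict gain because
  weights are positive.
\<close>

lemma walk_contains_path:
  assumes "xs \<noteq> []" "distinct_adj xs" "set xs \<subseteq> V" "positive_weight V w"
  shows "\<exists>ys. ys \<noteq> [] \<and> distinct ys \<and> set ys \<subseteq> set xs \<and> hd ys = hd xs \<and> last ys = last xs \<and>
    (ys = xs \<or> walk_length (\<lambda>x y. w {x, y}) ys < walk_length (\<lambda>x y. w {x, y}) xs)"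
  using assms
proof (induction xs rule: induct_list012)
  case (3 x y zs)
  let ?L = "walk_length (\<lambda>x y. w {x, y})"
  have pos: "0 < w {x, y}"
    using 3 by (auto simp: positive_weight_def)
  obtain ys where ys: "ys \<noteq> []" "distinct ys" "set ys \<subseteq> set (y # zs)" "hd ys = y"
      "last ys = last (y # zs)" "ys = y # zs \<or> ?L ys < ?L (y # zs)"
    using 3 by auto
  obtain ys' where ys': "ys = y # ys'"
    using ys by (cases ys) auto
  show ?case
  proof (cases "x \<in> set ys")
    case False
    then show ?thesis
      using ys ys' by (intro exI[of _ "x # ys"]) auto
  next
    case True
    then obtain as bs where split: "ys = as @ x # bs"
      by (meson split_list)
    have "distinct_adj (as @ [x])" "set (as @ [x]) \<subseteq> V"
      using ys split 3 by (auto intro!: distinct_imp_distinct_adj)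
    then have "0 \<le> ?L (as @ [x])"
      using 3 by (intro walk_length_nonneg) auto
    then have "?L (x # bs) \<le> ?L ys"
      using walk_length_append[of _ as x bs] split by simp
    then have "?L (x # bs) < ?L (x # y # zs)"
      using ys pos by auto
    then show ?thesis
      using ys split by (intro exI[of _ "x # bs"]) auto
  qed
next
  case (2 x)
  then show ?case by (intro exI[of _ "[x]"]) auto
qed auto

section \<open>Geodesic lists in a metric space\<close>

lemma (in Metric_space) dist_ends_le_walk_length:
  "xs \<noteq> [] \<Longrightarrow> set xs \<subseteq> M \<Longrightarrow> d (hd xs) (last xs) \<le> walk_length d xs"
proof (induction xs rule: induct_list012)
  case (3 x y zs)
  have "last (y # zs) \<in> set (y # zs)"
    by (rule last_in_set) simp
  then have "last (y # zs) \<in> M"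
    using 3(4) by auto
  then have "d x (last (y # zs)) \<le> d x y + d y (last (y # zs))"
    using 3(4) by (intro triangle) auto
  then show ?case using 3 by auto
qed auto

lemma (in Metric_space) dist_via_le_walk_length:
  assumes "c \<in> set xs" "set xs \<subseteq> M"
  shows "d (hd xs) c + d c (last xs) \<le> walk_length d xs"
proof -
  obtain as bs where xs: "xs = as @ c # bs"
    using assms by (meson split_list)
  have "d (hd (as @ [c])) c \<le> walk_length d (as @ [c])"
    using dist_ends_le_walk_length[of "as @ [c]"] assms xs by auto
  moreover have "d c (last (c # bs)) \<le> walk_length d (c # bs)"
    using dist_ends_le_walk_length[of "c # bs"] assms xs by auto
  ultimately show ?thesis
    using walk_length_append[of d as c bs] xs by (cases as) auto
qed

text \<open>
  This is the uniqueness part of the theorem. Suppose \<open>xs\<close> contains the whole metric interval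
  between its ends, and no step of \<open>ys\<close> can be refined. The second vertex \<open>y'\<close> of \<open>ys\<close> lies in
  the interval, hence on \<open>xs\<close>; the second vertex of \<open>xs\<close> lies between the common first
  vertex and \<open>y'\<close>, so it must equal \<open>y'\<close>. Both hypotheses pass to the tails.
\<close>

lemma (in Metric_space) geodesics_eq:
  assumes "xs \<noteq> []" "ys \<noteq> []" "distinct xs" "distinct ys" "set xs \<subseteq> M" "set ys \<subseteq> M"
    and "hd ys = hd xs" "last ys = last xs"
    and "walk_length d xs = d (hd xs) (last xs)" "walk_length d ys = d (hd xs) (last xs)"
    and "\<And>c. c \<in> M \<Longrightarrow> d (hd xs) (last xs) = d (hd xs) c + d c (last xs) \<Longrightarrow> c \<in> set xs"
    and "successively (\<lambda>x y. \<forall>c\<in>M. d x y = d x c + d c y \<longrightarrow> c = x \<or> c = y) ys"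
  shows "xs = ys"
  using assms
proof (induction ys arbitrary: xs rule: induct_list012)
  case (2 y)
  then show ?case
    by (cases xs) (auto split: if_splits dest: last_in_set)
next
  case (3 y y' ys)
  let ?v = "last (y' # ys)"
  have v_in: "?v \<in> set (y' # ys)"
    by (rule last_in_set) simp
  have "?v \<noteq> y"
    using v_in "3.prems"(4) by auto
  then obtain x xs' where xs: "xs = y # x # xs'"
    using "3.prems"(1,7,8) by (cases xs; cases "tl xs") (auto split: if_splits)
  have v: "?v = last (x # xs')"
    using "3.prems"(8) xs by simp
  have in_M: "y \<in> M" "y' \<in> M" "x \<in> M" "?v \<in> M" "set (y' # ys) \<subseteq> M" "set (x # xs') \<subseteq> M"
    using "3.prems"(5,6) xs v_in by auto
  have gx: "d y ?v = d y x + walk_length d (x # xs')"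
    using "3.prems"(9) xs v by simp
  have gy: "d y ?v = d y y' + walk_length d (y' # ys)"
    using "3.prems"(10) xs v by simp
  have le: "d x ?v \<le> walk_length d (x # xs')" "d y' ?v \<le> walk_length d (y' # ys)"
    using dist_ends_le_walk_length[of "x # xs'"] dist_ends_le_walk_length[of "y' # ys"] in_M v
    by auto
  have tri: "d y ?v \<le> d y x + d x ?v" "d y ?v \<le> d y y' + d y' ?v"
    using in_M by (auto intro: triangle)
  have interval: "c \<in> set xs" if "c \<in> M" "d y ?v = d y c + d c ?v" for c
    using "3.prems"(11)[of c] that xs v by auto
  have "y' \<in> set xs"
    using interval[of y'] in_M le gy tri by linarith
  then have "y' \<in> set (x # xs')"
    using "3.prems"(4) xs by auto
  then have "d x y' + d y' ?v \<le> walk_length d (x # xs')"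
    using dist_via_le_walk_length[of y' "x # xs'"] in_M v by auto
  moreover have "d y y' \<le> d y x + d x y'"
    using in_M by (auto intro: triangle)
  ultimately have "d y y' = d y x + d x y'"
    using gx tri by linarith
  moreover have "\<forall>c\<in>M. d y y' = d y c + d c y' \<longrightarrow> c = y \<or> c = y'"
    using "3.prems"(12) by simp
  ultimately have "x = y \<or> x = y'"
    using in_M by blast
  then have [simp]: "y' = x"
    using "3.prems"(3) xs by auto
  have "x # xs' = y' # ys"
  proof (rule "3.IH"(2))
    fix c assume c: "c \<in> M" "d (hd (x # xs')) (last (x # xs')) =
        d (hd (x # xs')) c + d c (last (x # xs'))"
    have "d y c \<le> d y x + d x c" "d y ?v \<le> d y c + d c ?v"
      using c in_M by (auto intro: triangle)
    then have "c \<in> set xs"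
      using c v gx tri le by (intro interval) auto
    moreover have "c \<noteq> y"
    proof
      assume "c = y"
      then have "d x ?v = d x y + d y ?v"
        using c(2) v by simp
      then have "d y ?v = d y x + (d x y + d y ?v)"
        using gx tri le unfolding \<open>y' = x\<close> by linarith
      then have "d y x = 0"
        using commute[of x y] nonneg[of x y] by linarith
      then show False
        using zero[of y x] in_M "3.prems"(3) xs by auto
    qed
    ultimately show "c \<in> set (x # xs')"
      using xs by auto
  next
    show "walk_length d (x # xs') = d (hd (x # xs')) (last (x # xs'))"
      using gx tri le v by simp
    show "walk_length d (y' # ys) = d (hd (x # xs')) (last (x # xs'))"
      using gy tri le v by simp
    show "last (y' # ys) = last (x # xs')"
      by (rule v)
    show "distinct (x # xs')" "distinct (y' # ys)"
      using "3.prems"(3,4) xs by auto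
    show "set (x # xs') \<subseteq> M" "set (y' # ys) \<subseteq> M"
      by (fact in_M)+
    show "successively (\<lambda>x y. \<forall>c\<in>M. d x y = d x c + d c y \<longrightarrow> c = x \<or> c = y) (y' # ys)"
      using "3.prems"(12) by simp
  qed simp_all
  then show ?case
    using xs by simp
qed auto

section \<open>Consistent path systems\<close>

lemma simple_path_between_list:
  "simple_path_between V u v (path_of_list xs)"
  if "xs \<noteq> []" "distinct xs" "set xs \<subseteq> V" "hd xs = u" "last xs = v"
  using that by (auto simp: simple_path_between_def)

lemma simple_path_between_commute:
  assumes "simple_path_between V u v p" shows "simple_path_between V v u p"
proof -
  obtain xs where "xs \<noteq> []" "distinct xs" "set xs \<subseteq> V" "hd xs = u" "last xs = v" "p = path_of_list xs"
    using assms by (auto simp: simple_path_between_def)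
  then show ?thesis
    using simple_path_between_list[of "rev xs" V v u]
    by (simp add: path_of_list_rev hd_rev last_rev)
qed

lemma the_path_commute: "the_path V P u v = the_path V P v u"
proof -
  have "simple_path_between V u v = simple_path_between V v u"
    by (auto dest: simple_path_between_commute)
  then show ?thesis by (simp add: the_path_def)
qed

lemma the_path:
  assumes "consistent_path_system V P" "u \<in> V" "v \<in> V" "u \<noteq> v"
  shows "the_path V P u v \<in> P" "simple_path_between V u v (the_path V P u v)"
proof -
  have "\<exists>!p. p \<in> P \<and> simple_path_between V u v p"
    using assms by (auto simp: consistent_path_system_def)
  from theI'[OF this] show "the_path V P u v \<in> P" "simple_path_between V u v (the_path V P u v)"
    by (auto simp: the_path_def)
qed

lemma the_path_eq:
  assumes "consistent_path_system V P" "u \<in> V" "v \<in> V" "u \<noteq> v" "p \<in> P" "simple_path_between V u v p"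
  shows "the_path V P u v = p"
  using assms the_path[OF assms(1-4)] unfolding consistent_path_system_def by blast

lemma path_inter_in_system:
  assumes "consistent_path_system V P" "p \<in> P" "q \<in> P" "verts p \<inter> verts q \<noteq> {}"
  shows "(\<exists>v. path_inter p q = ({v}, {})) \<or> path_inter p q \<in> P"
proof -
  have "\<forall>p\<in>P. \<forall>q\<in>P. verts p \<inter> verts q \<noteq> {} \<longrightarrow>
      (\<exists>v. path_inter p q = ({v}, {})) \<or> path_inter p q \<in> P"
    using assms(1) unfolding consistent_path_system_def by (elim conjE)
  from this[rule_format, OF assms(2-4)] show ?thesis .
qed

lemma path_triples_iff:
  "({a, b}, c) \<in> path_triples V P \<longleftrightarrow>
     ({a, b}, c) \<in> pointed_triples V \<and> c \<in> verts (the_path V P a b)"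
proof
  assume "({a, b}, c) \<in> path_triples V P"
  then obtain a' b' where "{a, b} = {a', b'}" "({a', b'}, c) \<in> pointed_triples V"
    "c \<in> verts (the_path V P a' b')"
    by (auto simp: path_triples_def)
  then show "({a, b}, c) \<in> pointed_triples V \<and> c \<in> verts (the_path V P a b)"
    using the_path_commute[of V P] by (metis doubleton_eq_iff)
qed (auto simp: path_triples_def)

lemma metric_triples_iff:
  assumes "Metric_space V \<rho>"
  shows "({a, b}, c) \<in> metric_triples V \<rho> \<longleftrightarrow>
     ({a, b}, c) \<in> pointed_triples V \<and> \<rho> a b = \<rho> a c + \<rho> c b"
proof -
  have "\<rho> x y = \<rho> y x" for x y
    using assms by (auto simp: Metric_space_def)
  then have swap: "\<rho> b a = \<rho> b c + \<rho> c a \<longleftrightarrow> \<rho> a b = \<rho> a c + \<rho> c b"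
    by (metis add.commute)
  show ?thesis
  proof
    assume "({a, b}, c) \<in> metric_triples V \<rho>"
    then obtain a' b' where "{a, b} = {a', b'}" "({a', b'}, c) \<in> pointed_triples V"
      "\<rho> a' b' = \<rho> a' c + \<rho> c b'"
      by (auto simp: metric_triples_def)
    then show "({a, b}, c) \<in> pointed_triples V \<and> \<rho> a b = \<rho> a c + \<rho> c b"
      using swap by (metis doubleton_eq_iff)
  qed (auto simp: metric_triples_def)
qed

lemma pointed_triples_iff:
  "({a, b}, c) \<in> pointed_triples V \<longleftrightarrow> a \<in> V \<and> b \<in> V \<and> c \<in> V \<and> a \<noteq> b \<and> a \<noteq> c \<and> b \<noteq> c"
  unfolding pointed_triples_def by (auto simp: doubleton_eq_iff)

lemma path_triples_subset_pointed: "path_triples V P \<subseteq> pointed_triples V"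
  by (auto simp: path_triples_def)

lemma metric_triples_subset_pointed: "metric_triples V \<rho> \<subseteq> pointed_triples V"
  by (auto simp: metric_triples_def)

lemma pointed_triples_subsetI:
  assumes "T \<subseteq> pointed_triples V" "\<And>a b c. ({a, b}, c) \<in> T \<Longrightarrow> ({a, b}, c) \<in> T'"
  shows "T \<subseteq> T'"
proof
  fix t assume t: "t \<in> T"
  then obtain a b c where "t = ({a, b}, c)"
    using assms(1) unfolding pointed_triples_def by blast
  then show "t \<in> T'"
    using t assms(2) by blast
qed

text \<open>
  Deleting the edge between positions \<open>k\<close> and \<open>k + 1\<close> disconnects the path \<open>xs\<close>, so a walk along
  its edges that visits both sides has to use that edge.
\<close>

lemma walk_crosses_edge:
  assumes "distinct xs" "edges (path_of_list zs) \<subseteq> edges (path_of_list xs)"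
    and "xs ! i \<in> set zs" "xs ! j \<in> set zs" "i \<le> k" "k < j" "j < length xs"
  shows "{xs ! k, xs ! Suc k} \<in> edges (path_of_list zs)"
proof (rule ccontr)
  assume unused: "{xs ! k, xs ! Suc k} \<notin> edges (path_of_list zs)"
  define Q where "Q x \<longleftrightarrow> (\<exists>m\<le>k. x = xs ! m)" for x
  have Q_nth: "Q (xs ! m) \<longleftrightarrow> m \<le> k" if "m < length xs" for m
    using that assms by (auto simp: Q_def nth_eq_iff_index_eq)
  have step: "Q (zs ! n) \<longleftrightarrow> Q (zs ! Suc n)" if n: "Suc n < length zs" for n
  proof -
    have "{zs ! n, zs ! Suc n} \<in> edges (path_of_list xs)"
      using assms edge_path_of_list_nth[OF n] by auto
    then obtain m where m: "{zs ! n, zs ! Suc n} = {xs ! m, xs ! Suc m}" "Suc m < length xs"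
      by (auto simp: path_of_list_def)
    then have "m \<noteq> k"
      using unused edge_path_of_list_nth[OF n] by auto
    then have "Q (xs ! m) \<longleftrightarrow> Q (xs ! Suc m)"
      using Q_nth m by auto
    then show ?thesis
      using m by (auto simp: doubleton_eq_iff)
  qed
  have const: "n < length zs \<Longrightarrow> Q (zs ! n) \<longleftrightarrow> Q (zs ! 0)" for n
    by (induction n) (auto simp: step)
  then have "Q (xs ! i) \<longleftrightarrow> Q (xs ! j)"
    using assms(3,4) by (metis in_set_conv_nth)
  then show False
    using Q_nth assms by auto
qed

text \<open>
  Consistency enters the proof through this lemma. The intersection of a path with the path joining two
  of its vertices is itself connected, so it contains the whole segment between them.
\<close>

lemma segment_edge_in_the_path:
  assumes cps: "consistent_path_system V P" and p: "path_of_list xs \<in> P"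
    and xs: "distinct xs" "set xs \<subseteq> V" and ij: "i \<le> k" "k < j" "j < length xs"
  shows "{xs ! k, xs ! Suc k} \<in> edges (the_path V P (xs ! i) (xs ! j))"
proof -
  let ?p = "path_of_list xs" and ?r = "the_path V P (xs ! i) (xs ! j)"
  let ?q = "path_inter ?p ?r"
  have ne: "xs ! i \<noteq> xs ! j"
    using xs ij by (simp add: nth_eq_iff_index_eq)
  have V: "xs ! i \<in> V" "xs ! j \<in> V"
    using xs ij by auto
  note r = the_path[OF cps V ne]
  have "xs ! i \<in> verts ?r" "xs ! j \<in> verts ?r"
    using r(2) hd_in_set last_in_set by (fastforce simp: simple_path_between_def)+
  then have ends: "xs ! i \<in> verts ?q" "xs ! j \<in> verts ?q"
    using ij by (auto simp: path_inter_def)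
  then have "verts ?p \<inter> verts ?r \<noteq> {}"
    by (auto simp: path_inter_def)
  then have "(\<exists>v. ?q = ({v}, {})) \<or> ?q \<in> P"
    using path_inter_in_system[OF cps p r(1)] by simp
  then have "?q \<in> P"
    using ends ne by auto
  then obtain zs where zs: "?q = path_of_list zs"
    using cps unfolding consistent_path_system_def simple_path_between_def by blast
  have "{xs ! k, xs ! Suc k} \<in> edges (path_of_list zs)"
  proof (rule walk_crosses_edge[OF xs(1) _ _ _ ij])
    show "edges (path_of_list zs) \<subseteq> edges ?p"
      unfolding zs[symmetric] by (auto simp: path_inter_def)
  qed (use ends zs in auto)
  then show ?thesis
    unfolding zs[symmetric] by (auto simp: path_inter_def)
qed

lemma verts_of_edge_path:
  assumes "simple_path_between V u v p" "{u, v} \<in> edges p" "u \<noteq> v"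
  shows "verts p = {u, v}"
proof -
  obtain xs where xs: "xs \<noteq> []" "distinct xs" "hd xs = u" "last xs = v" "p = path_of_list xs"
    using assms by (auto simp: simple_path_between_def)
  obtain i where i: "{u, v} = {xs ! i, xs ! Suc i}" "Suc i < length xs"
    using assms xs by (auto simp: path_of_list_def)
  have uv: "u = xs ! 0" "v = xs ! (length xs - 1)"
    using xs by (auto simp: hd_conv_nth last_conv_nth)
  have "xs ! 0 = xs ! i \<or> xs ! 0 = xs ! Suc i" "xs ! (length xs - 1) = xs ! i \<or> xs ! (length xs - 1) = xs ! Suc i"
    using i uv by auto
  then have "i = 0" "length xs = 2"
    using xs i by (auto simp: nth_eq_iff_index_eq)
  then obtain a b where "xs = [a, b]"
    by (auto simp: length_Suc_conv numeral_2_eq_2)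
  then show ?thesis
    using xs by auto
qed

section \<open>From a weight to a metric\<close>

definition path_dist :: "'a set \<Rightarrow> 'a path set \<Rightarrow> ('a set \<Rightarrow> real) \<Rightarrow> 'a \<Rightarrow> 'a \<Rightarrow> real" where
  "path_dist V P w u v =
     (if u \<in> V \<and> v \<in> V \<and> u \<noteq> v then path_weight w (the_path V P u v) else 0)"

context
  fixes V :: "'a set" and P :: "'a path set" and w :: "'a set \<Rightarrow> real"
  assumes cps: "consistent_path_system V P"
    and pos: "positive_weight V w"
    and shortest: "\<And>p u v. p \<in> P \<Longrightarrow> simple_path_between V u v p \<Longrightarrow> shortest_path V w u v p"
begin

lemma the_path_list:
  assumes "u \<in> V" "v \<in> V" "u \<noteq> v"
  obtains xs where "xs \<noteq> []" "distinct xs" "set xs \<subseteq> V" "hd xs = u" "last xs = v"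
    "the_path V P u v = path_of_list xs"
    "path_dist V P w u v = walk_length (\<lambda>x y. w {x, y}) xs"
proof -
  obtain xs where "xs \<noteq> []" "distinct xs" "set xs \<subseteq> V" "hd xs = u" "last xs = v"
    "the_path V P u v = path_of_list xs"
    using the_path(2)[OF cps assms] by (auto simp: simple_path_between_def)
  then show ?thesis
    using that[of xs] assms by (simp add: path_dist_def path_weight_path_of_list)
qed

lemma path_dist_le_walk:
  assumes "xs \<noteq> []" "distinct_adj xs" "set xs \<subseteq> V"
  shows "path_dist V P w (hd xs) (last xs) \<le> walk_length (\<lambda>x y. w {x, y}) xs"
proof (cases "hd xs = last xs")
  case True
  then show ?thesis
    using walk_length_nonneg[OF assms(2,3) pos] by (simp add: path_dist_def)
next
  case False
  let ?u = "hd xs" and ?v = "last xs"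
  have V: "?u \<in> V" "?v \<in> V"
    using assms by auto
  obtain ys where ys: "ys \<noteq> []" "distinct ys" "set ys \<subseteq> set xs" "hd ys = ?u" "last ys = ?v"
    "ys = xs \<or> walk_length (\<lambda>x y. w {x, y}) ys < walk_length (\<lambda>x y. w {x, y}) xs"
    using walk_contains_path[OF assms pos] by blast
  have "simple_path_between V ?u ?v (path_of_list ys)"
    using ys assms by (intro simple_path_between_list) auto
  then have "path_weight w (the_path V P ?u ?v) \<le> path_weight w (path_of_list ys)"
    using shortest[OF the_path[OF cps V False]] unfolding shortest_path_def by blast
  then show ?thesis
    using V False ys by (auto simp: path_dist_def path_weight_path_of_list)
qed

text \<open>
  Concatenating two paths of the system gives a walk, which realises the right-hand side of the
  triangle inequality.
\<close>

lemma concatenated_paths: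
  assumes "a \<in> V" "b \<in> V" "c \<in> V" "a \<noteq> c" "c \<noteq> b"
  obtains xs where "xs \<noteq> []" "distinct_adj xs" "set xs \<subseteq> V" "hd xs = a" "last xs = b" "c \<in> set xs"
    "walk_length (\<lambda>x y. w {x, y}) xs = path_dist V P w a c + path_dist V P w c b"
proof -
  obtain xs where xs: "xs \<noteq> []" "distinct xs" "set xs \<subseteq> V" "hd xs = a" "last xs = c"
    "path_dist V P w a c = walk_length (\<lambda>x y. w {x, y}) xs"
    using the_path_list[of a c] assms by metis
  obtain ys where ys: "ys \<noteq> []" "distinct ys" "set ys \<subseteq> V" "hd ys = c" "last ys = b"
    "path_dist V P w c b = walk_length (\<lambda>x y. w {x, y}) ys"
    using the_path_list[of c b] assms by metis
  obtain as where as: "xs = as @ [c]" using xs by (metis append_butlast_last_id)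
  obtain bs where bs: "ys = c # bs" using ys by (cases ys) auto
  have "distinct_adj xs" "distinct_adj ys"
    using xs ys by (auto intro: distinct_imp_distinct_adj)
  then have adj: "distinct_adj (as @ c # bs)"
    unfolding as bs by (auto simp: distinct_adj_append_iff)
  show ?thesis
  proof (rule that[of "as @ c # bs"])
    show "walk_length (\<lambda>x y. w {x, y}) (as @ c # bs) = path_dist V P w a c + path_dist V P w c b"
      using walk_length_append[of _ as c bs] xs ys as bs by simp
    show "hd (as @ c # bs) = a"
      using xs as by (cases as) auto
  qed (use adj xs ys as bs in auto)
qed

lemma Metric_space_path_dist: "Metric_space V (path_dist V P w)"
proof
  show nonneg: "0 \<le> path_dist V P w x y" for x y
  proof (cases "x \<in> V \<and> y \<in> V \<and> x \<noteq> y")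
    case True
    then show ?thesis
      using walk_length_nonneg[OF _ _ pos] the_path_list[of x y] distinct_imp_distinct_adj by metis
  qed (auto simp: path_dist_def)
  show "path_dist V P w x y = path_dist V P w y x" for x y
    using the_path_commute[of V P x y] by (auto simp: path_dist_def)
  show "path_dist V P w x y = 0 \<longleftrightarrow> x = y" if xy: "x \<in> V" "y \<in> V" for x y
  proof
    assume zero: "path_dist V P w x y = 0"
    show "x = y"
    proof (rule ccontr)
      assume ne: "x \<noteq> y"
      obtain xs where xs: "xs \<noteq> []" "distinct xs" "set xs \<subseteq> V" "hd xs = x" "last xs = y"
        "path_dist V P w x y = walk_length (\<lambda>x y. w {x, y}) xs"
        using the_path_list[of x y] xy ne by metis
      obtain z zs where z: "xs = x # z # zs"
        using xs ne by (cases xs; cases "tl xs") auto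
      have "0 < w {x, z}"
        using xs z pos by (auto simp: positive_weight_def)
      moreover have "0 \<le> walk_length (\<lambda>x y. w {x, y}) (z # zs)"
        using xs z by (intro walk_length_nonneg[OF _ _ pos]) (auto intro!: distinct_imp_distinct_adj)
      ultimately show False
        using zero xs z by simp
    qed
  qed (simp add: path_dist_def)
  show "path_dist V P w x z \<le> path_dist V P w x y + path_dist V P w y z"
    if V: "x \<in> V" "y \<in> V" "z \<in> V" for x y z
  proof (cases "x = y \<or> y = z")
    case True
    then show ?thesis
      by (auto simp: path_dist_def)
  next
    case False
    then obtain xs where "xs \<noteq> []" "distinct_adj xs" "set xs \<subseteq> V" "hd xs = x" "last xs = z"
      "walk_length (\<lambda>x y. w {x, y}) xs = path_dist V P w x y + path_dist V P w y z"
      using concatenated_paths[of x z y] V by metis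
    then show ?thesis
      using path_dist_le_walk[of xs] by simp
  qed
qed

text \<open>
  A path \<open>P\<^bsub>a,b\<^esub>\<close> through \<open>c\<close> splits at \<open>c\<close> into two walks, which are at least as long as the
  paths of the system with the same ends; the triangle inequality supplies the converse.
\<close>

lemma path_triples_subset_metric_triples:
  "path_triples V P \<subseteq> metric_triples V (path_dist V P w)"
proof -
  interpret Metric_space V "path_dist V P w" by (rule Metric_space_path_dist)
  have "({a, b}, c) \<in> metric_triples V (path_dist V P w)" if t: "({a, b}, c) \<in> path_triples V P" for a b c
  proof -
    have pt: "({a, b}, c) \<in> pointed_triples V" and c: "c \<in> verts (the_path V P a b)"
      using t by (auto simp: path_triples_iff)
    then have V: "a \<in> V" "b \<in> V" "c \<in> V" "a \<noteq> b"
      by (auto simp: pointed_triples_iff)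
    obtain xs where xs: "xs \<noteq> []" "distinct xs" "set xs \<subseteq> V" "hd xs = a" "last xs = b"
      "the_path V P a b = path_of_list xs" "path_dist V P w a b = walk_length (\<lambda>x y. w {x, y}) xs"
      using the_path_list[of a b] V by metis
    obtain as bs where split: "xs = as @ c # bs"
      using c xs(6) by (auto dest: split_list)
    have ends: "hd (as @ [c]) = a" "last (c # bs) = b"
      using xs split by (cases as; auto)+
    have "path_dist V P w a c \<le> walk_length (\<lambda>x y. w {x, y}) (as @ [c])"
      using path_dist_le_walk[of "as @ [c]"] ends xs split distinct_imp_distinct_adj[of "as @ [c]"]
      by auto
    moreover have "path_dist V P w c b \<le> walk_length (\<lambda>x y. w {x, y}) (c # bs)"
      using path_dist_le_walk[of "c # bs"] ends xs split distinct_imp_distinct_adj[of "c # bs"]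
      by auto
    moreover have "path_dist V P w a b \<le> path_dist V P w a c + path_dist V P w c b"
      using V by (intro triangle)
    ultimately have "path_dist V P w a b = path_dist V P w a c + path_dist V P w c b"
      using xs(7) walk_length_append[of "\<lambda>x y. w {x, y}" as c bs] split by simp
    then show ?thesis
      using pt by (simp add: metric_triples_iff[OF Metric_space_path_dist])
  qed
  then show ?thesis
    by (metis pointed_triples_subsetI path_triples_subset_pointed)
qed

text \<open>
  Conversely, if \<open>c\<close> lies metrically between \<open>a\<close> and \<open>b\<close>, then the walk from \<open>a\<close> through \<open>c\<close> to
  \<open>b\<close> has minimal length. So it has no cycle to cut out, and by uniqueness it is \<open>P\<^bsub>a,b\<^esub>\<close>.
\<close>

lemma metric_triples_subset_path_triples:
  assumes unique: "\<And>p u v. p \<in> P \<Longrightarrow> simple_path_between V u v p \<Longrightarrow> unique_shortest_path V w u v p"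
  shows "metric_triples V (path_dist V P w) \<subseteq> path_triples V P"
proof -
  let ?L = "walk_length (\<lambda>x y. w {x, y})"
  have "({a, b}, c) \<in> path_triples V P"
    if t: "({a, b}, c) \<in> metric_triples V (path_dist V P w)" for a b c
  proof -
    have pt: "({a, b}, c) \<in> pointed_triples V"
      and eq: "path_dist V P w a b = path_dist V P w a c + path_dist V P w c b"
      using t by (auto simp: metric_triples_iff[OF Metric_space_path_dist])
    then have V: "a \<in> V" "b \<in> V" "c \<in> V" and ne: "a \<noteq> b" "a \<noteq> c" "c \<noteq> b"
      by (auto simp: pointed_triples_iff)
    obtain xs where xs: "xs \<noteq> []" "distinct_adj xs" "set xs \<subseteq> V" "hd xs = a" "last xs = b" "c \<in> set xs"
      "?L xs = path_dist V P w a c + path_dist V P w c b"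
      using concatenated_paths[OF V ne(2,3)] by metis
    obtain ys where ys: "ys \<noteq> []" "distinct ys" "set ys \<subseteq> set xs" "hd ys = a" "last ys = b"
      "ys = xs \<or> ?L ys < ?L xs"
      using walk_contains_path[OF xs(1-3) pos] xs by blast
    have "path_dist V P w a b \<le> ?L ys"
      using path_dist_le_walk[of ys] ys xs distinct_imp_distinct_adj[of ys] by auto
    then have [simp]: "ys = xs"
      using ys xs eq by linarith
    have sp: "simple_path_between V a b (path_of_list xs)"
      using ys xs by (intro simple_path_between_list) auto
    have u: "unique_shortest_path V w a b (the_path V P a b)"
      using unique the_path[OF cps V(1,2) ne(1)] by auto
    have "path_weight w (path_of_list xs) = path_weight w (the_path V P a b)"
      using ys xs eq V ne by (simp add: path_weight_path_of_list path_dist_def)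
    then have "shortest_path V w a b (path_of_list xs)"
      using u sp by (simp add: unique_shortest_path_def shortest_path_def)
    then have "path_of_list xs = the_path V P a b"
      using u unfolding unique_shortest_path_def by blast
    then have "c \<in> verts (the_path V P a b)"
      using xs by (metis verts_path_of_list)
    then show ?thesis
      using pt by (simp add: path_triples_iff)
  qed
  then show ?thesis
    by (metis pointed_triples_subsetI metric_triples_subset_pointed)
qed

end

section \<open>From a metric to a weight\<close>

text \<open>
  The edge \<open>{x, y}\<close> gets weight \<open>\<rho> x y\<close>, raised by 1 when no path of the system uses it. Without
  the surcharge the single edge \<open>{x, y}\<close> would be a shortest path even when \<open>P\<^bsub>x,y\<^esub>\<close> is longer, so
  strictness would fail. For symmetric \<open>\<rho>\<close> the choice of the order of the two ends is immaterial.
\<close>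

definition system_weight :: "'a path set \<Rightarrow> ('a \<Rightarrow> 'a \<Rightarrow> real) \<Rightarrow> 'a set \<Rightarrow> real" where
  "system_weight P \<rho> e =
     (SOME r. \<exists>x y. e = {x, y} \<and> r = \<rho> x y) + (if e \<in> \<Union> (edges ` P) then 0 else 1)"

lemma system_weight_edge:
  assumes "\<And>x y. \<rho> x y = \<rho> y x"
  shows "system_weight P \<rho> {x, y} = \<rho> x y + (if {x, y} \<in> \<Union> (edges ` P) then 0 else 1)"
proof -
  have "(SOME r. \<exists>a b. {x, y} = {a, b} \<and> r = \<rho> a b) = \<rho> x y"
    by (rule some_equality) (use assms in \<open>auto simp: doubleton_eq_iff\<close>)
  then show ?thesis
    by (simp add: system_weight_def)
qed

context
  fixes V :: "'a set" and P :: "'a path set" and \<rho> :: "'a \<Rightarrow> 'a \<Rightarrow> real"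
  assumes cps: "consistent_path_system V P"
    and metric: "Metric_space V \<rho>"
    and triples: "path_triples V P \<subseteq> metric_triples V \<rho>"
begin

interpretation Metric_space V \<rho> by (rule metric)

lemma system_weight_doubleton:
  "system_weight P \<rho> {x, y} = \<rho> x y + (if {x, y} \<in> \<Union> (edges ` P) then 0 else 1)"
  by (rule system_weight_edge) (rule commute)

lemma positive_system_weight: "positive_weight V (system_weight P \<rho>)"
  unfolding positive_weight_def
proof (intro allI impI)
  fix e :: "'a set" assume e: "e \<subseteq> V \<and> card e = 2"
  then obtain x y where "e = {x, y}" "x \<noteq> y"
    by (auto simp: card_2_iff)
  then have "0 < \<rho> x y"
    using e mdist_pos_less[of x y] by auto
  then show "system_weight P \<rho> e > 0"
    using \<open>e = {x, y}\<close> by (simp add: system_weight_doubleton)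
qed

lemma walk_length_le_system_weight:
  "walk_length \<rho> xs \<le> walk_length (\<lambda>x y. system_weight P \<rho> {x, y}) xs"
  by (induction xs rule: induct_list012) (auto simp: system_weight_doubleton)

text \<open>Because of the surcharge, equality forces every edge to belong to the system.\<close>

lemma walk_length_eq_system_weight_iff:
  "walk_length (\<lambda>x y. system_weight P \<rho> {x, y}) xs = walk_length \<rho> xs \<longleftrightarrow>
     edges (path_of_list xs) \<subseteq> \<Union> (edges ` P)"
proof (induction xs rule: induct_list012)
  case (3 x y zs)
  show ?case
    using 3 walk_length_le_system_weight[of "y # zs"]
    by (auto simp: system_weight_doubleton edges_path_of_list_Cons_Cons)
qed auto

text \<open>
  Each vertex of the path lies on the path of the system from its predecessor to the last vertex.
  The resulting metric triples telescope.
\<close>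

lemma walk_length_system_path:
  assumes p: "path_of_list xs \<in> P" and xs: "distinct xs" "set xs \<subseteq> V" "xs \<noteq> []"
  shows "walk_length \<rho> xs = \<rho> (hd xs) (last xs)"
proof -
  \<comment> \<open>Induct over the suffixes of the fixed path: a suffix need not be known to lie in the system.\<close>
  have "xs = as @ ys \<Longrightarrow> ys \<noteq> [] \<Longrightarrow> walk_length \<rho> ys = \<rho> (hd ys) (last ys)" for as ys
  proof (induction ys arbitrary: as rule: induct_list012)
    case (2 y)
    then show ?case using xs zero[of y y] by auto
  next
    case (3 y y' zs)
    let ?v = "last (y' # zs)"
    have IH: "walk_length \<rho> (y' # zs) = \<rho> y' ?v"
      using "3.IH"(2)[of "as @ [y]"] "3.prems" by simp
    have in_V: "y \<in> V" "y' \<in> V" "?v \<in> V"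
      using 3(3) xs last_in_set[of "y' # zs"] by auto
    have "\<rho> y ?v = \<rho> y y' + \<rho> y' ?v"
    proof (cases "y' = ?v")
      case True
      then have "\<rho> y' ?v = 0"
        using in_V zero[of y' ?v] by blast
      then show ?thesis
        using True by simp
    next
      case False
      have ne: "y \<noteq> y'" "y \<noteq> ?v"
        using 3(3) xs last_in_set[of "y' # zs"] by auto
      let ?k = "length as" and ?j = "length xs - 1"
      have nth: "xs ! ?k = y" "xs ! Suc ?k = y'" "xs ! ?j = ?v"
        using 3(3) by (auto simp: nth_append last_conv_nth)
      have "{y, y'} \<in> edges (the_path V P y ?v)"
        using segment_edge_in_the_path[OF cps p xs(1,2), of ?k ?k ?j] nth 3(3) by auto
      moreover obtain zs' where "the_path V P y ?v = path_of_list zs'"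
        using the_path(2)[OF cps in_V(1,3) ne(2)] by (auto simp: simple_path_between_def)
      ultimately have "y' \<in> verts (the_path V P y ?v)"
        using edges_path_of_list_subset by fastforce
      then have "({y, ?v}, y') \<in> path_triples V P"
        using in_V ne False by (auto simp: path_triples_iff pointed_triples_iff)
      then have "({y, ?v}, y') \<in> metric_triples V \<rho>"
        using triples by blast
      then show ?thesis
        by (simp add: metric_triples_iff[OF metric])
    qed
    then show ?case
      using IH by simp
  qed auto
  from this[of "[]" xs] show ?thesis
    using xs by simp
qed

lemma system_paths_weight:
  assumes "p \<in> P" "simple_path_between V u v p"
  shows "path_weight (system_weight P \<rho>) p = \<rho> u v"
proof -
  obtain xs where xs: "xs \<noteq> []" "distinct xs" "set xs \<subseteq> V" "hd xs = u" "last xs = v" "p = path_of_list xs"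
    using assms by (auto simp: simple_path_between_def)
  have "edges (path_of_list xs) \<subseteq> \<Union> (edges ` P)"
    using assms xs by blast
  then show ?thesis
    using xs assms walk_length_eq_system_weight_iff[of xs] walk_length_system_path[of xs]
    by (simp add: path_weight_path_of_list)
qed

lemma system_paths_shortest:
  assumes "p \<in> P" "simple_path_between V u v p"
  shows "shortest_path V (system_weight P \<rho>) u v p"
  unfolding shortest_path_def
proof (intro conjI allI impI)
  fix q assume "simple_path_between V u v q"
  then obtain ys where ys: "ys \<noteq> []" "distinct ys" "set ys \<subseteq> V" "hd ys = u" "last ys = v" "q = path_of_list ys"
    by (auto simp: simple_path_between_def)
  then have "\<rho> u v \<le> path_weight (system_weight P \<rho>) q"
    using dist_ends_le_walk_length[of ys] walk_length_le_system_weight[of ys]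
    by (simp add: path_weight_path_of_list)
  then show "path_weight (system_weight P \<rho>) p \<le> path_weight (system_weight P \<rho>) q"
    using system_paths_weight[OF assms] by simp
qed (rule assms)

text \<open>
  An edge used anywhere in the system is the path between its ends, so with equality of
  triples there is no point metrically between them.
\<close>

lemma system_edge_unrefinable:
  assumes converse: "metric_triples V \<rho> \<subseteq> path_triples V P"
    and e: "{x, y} \<in> \<Union> (edges ` P)" and V: "x \<in> V" "y \<in> V" "c \<in> V" "x \<noteq> y"
    and between: "\<rho> x y = \<rho> x c + \<rho> c y"
  shows "c = x \<or> c = y"
proof (rule ccontr)
  assume "\<not> (c = x \<or> c = y)"
  then have "({x, y}, c) \<in> metric_triples V \<rho>"
    using V between by (auto simp: metric_triples_iff[OF metric] pointed_triples_iff)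
  then have c: "c \<in> verts (the_path V P x y)"
    using converse by (auto simp: path_triples_iff)
  obtain p where p: "p \<in> P" "{x, y} \<in> edges p"
    using e by auto
  then obtain u v where "simple_path_between V u v p"
    using cps unfolding consistent_path_system_def by blast
  then obtain zs where zs: "distinct zs" "set zs \<subseteq> V" "p = path_of_list zs"
    by (auto simp: simple_path_between_def)
  obtain i where i: "{x, y} = {zs ! i, zs ! Suc i}" "Suc i < length zs"
    using p zs by (auto simp: path_of_list_def)
  have "{zs ! i, zs ! Suc i} \<in> edges (the_path V P (zs ! i) (zs ! Suc i))"
    using segment_edge_in_the_path[OF cps _ zs(1,2), of i i "Suc i"] p zs i by auto
  then have "{x, y} \<in> edges (the_path V P x y)"
    using i the_path_commute[of V P x y] by (auto simp: doubleton_eq_iff insert_commute)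
  then have "verts (the_path V P x y) = {x, y}"
    using verts_of_edge_path[OF the_path(2)[OF cps V(1,2,4)]] V by auto
  then show False
    using c \<open>\<not> (c = x \<or> c = y)\<close> by auto
qed

lemma system_paths_unique_shortest:
  assumes converse: "metric_triples V \<rho> \<subseteq> path_triples V P"
    and p: "p \<in> P" "simple_path_between V u v p"
  shows "unique_shortest_path V (system_weight P \<rho>) u v p"
  unfolding unique_shortest_path_def
proof (intro conjI allI impI)
  show short: "shortest_path V (system_weight P \<rho>) u v p"
    by (rule system_paths_shortest[OF p])
  fix q assume q: "shortest_path V (system_weight P \<rho>) u v q"
  obtain xs where xs: "xs \<noteq> []" "distinct xs" "set xs \<subseteq> V" "hd xs = u" "last xs = v" "p = path_of_list xs"
    using p by (auto simp: simple_path_between_def)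
  obtain ys where ys: "ys \<noteq> []" "distinct ys" "set ys \<subseteq> V" "hd ys = u" "last ys = v" "q = path_of_list ys"
    using q by (auto simp: shortest_path_def simple_path_between_def)
  have uv: "u \<in> V" "v \<in> V"
    using xs hd_in_set[of xs] last_in_set[of xs] by blast+
  have "path_weight (system_weight P \<rho>) q \<le> path_weight (system_weight P \<rho>) p"
    using q p unfolding shortest_path_def by blast
  then have le: "walk_length (\<lambda>x y. system_weight P \<rho> {x, y}) ys \<le> \<rho> u v"
    using system_paths_weight[OF p] ys by (simp add: path_weight_path_of_list)
  then have gy: "walk_length \<rho> ys = \<rho> u v"
    and no_surcharge: "walk_length (\<lambda>x y. system_weight P \<rho> {x, y}) ys = walk_length \<rho> ys"
    using dist_ends_le_walk_length[of ys] walk_length_le_system_weight[of ys] ys by auto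
  have edges: "edges (path_of_list ys) \<subseteq> \<Union> (edges ` P)"
    using no_surcharge by (rule walk_length_eq_system_weight_iff[THEN iffD1])
  have "xs = ys"
  proof (rule geodesics_eq)
    show "walk_length \<rho> xs = \<rho> (hd xs) (last xs)"
      using walk_length_system_path[of xs] p xs by auto
    show "walk_length \<rho> ys = \<rho> (hd xs) (last xs)"
      using gy xs by simp
    show "c \<in> set xs" if c: "c \<in> V" "\<rho> (hd xs) (last xs) = \<rho> (hd xs) c + \<rho> c (last xs)" for c
    proof (cases "c = u \<or> c = v")
      case True
      then show ?thesis using xs by auto
    next
      case False
      have "u \<noteq> v"
      proof
        assume uv_eq: "u = v"
        then have "0 = \<rho> u c + \<rho> c u"
          using c xs uv by simp
        then have "\<rho> u c = 0"
          using nonneg[of u c] nonneg[of c u] by linarith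
        then show False
          using zero[of u c] False uv c(1) by blast
      qed
      then have "({u, v}, c) \<in> metric_triples V \<rho>"
        using c xs uv False by (auto simp: metric_triples_iff[OF metric] pointed_triples_iff)
      then have "c \<in> verts (the_path V P u v)"
        using converse by (auto simp: path_triples_iff)
      then show ?thesis
        using the_path_eq[OF cps uv \<open>u \<noteq> v\<close> p] xs by simp
    qed
    show "successively (\<lambda>x y. \<forall>c\<in>V. \<rho> x y = \<rho> x c + \<rho> c y \<longrightarrow> c = x \<or> c = y) ys"
      unfolding successively_conv_nth
    proof (intro allI impI ballI)
      fix i c
      assume i: "Suc i < length ys" and c: "c \<in> V"
        "\<rho> (ys ! i) (ys ! Suc i) = \<rho> (ys ! i) c + \<rho> c (ys ! Suc i)"
      have "{ys ! i, ys ! Suc i} \<in> \<Union> (edges ` P)"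
        using edges edge_path_of_list_nth[OF i] by blast
      moreover have "ys ! i \<in> V" "ys ! Suc i \<in> V"
        using ys i by auto
      moreover have "ys ! i \<noteq> ys ! Suc i"
        using ys i by (simp add: nth_eq_iff_index_eq)
      ultimately show "c = ys ! i \<or> c = ys ! Suc i"
        using system_edge_unrefinable[OF converse] c by blast
    qed
  qed (use xs ys in auto)
  then show "q = p"
    using xs ys by simp
qed

end

section \<open>The characterisation\<close>

theorem theorem4p1:
  fixes V :: "'a set" and P :: "'a path set"
  assumes "finite V"
    and "consistent_path_system V P"
  shows "(strictly_metric_path_system V P \<longleftrightarrow>
            (\<exists>\<rho>. Metric_space V \<rho> \<and> path_triples V P = metric_triples V \<rho>)) \<and>
         (metric_path_system V P \<longleftrightarrow>
            (\<exists>\<rho>. Metric_space V \<rho> \<and> path_triples V P \<subseteq> metric_triples V \<rho>))"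
proof (intro conjI iffI)
  note cps = assms(2)
  {
    assume "strictly_metric_path_system V P"
    then obtain w where pos: "positive_weight V w"
      and unique: "\<And>p u v. p \<in> P \<Longrightarrow> simple_path_between V u v p \<Longrightarrow> unique_shortest_path V w u v p"
      by (auto simp: strictly_metric_path_system_def)
    have short: "shortest_path V w u v p" if "p \<in> P" "simple_path_between V u v p" for p u v
      using unique[OF that] by (simp add: unique_shortest_path_def)
    show "\<exists>\<rho>. Metric_space V \<rho> \<and> path_triples V P = metric_triples V \<rho>"
      using Metric_space_path_dist[OF cps pos short]
        path_triples_subset_metric_triples[OF cps pos short]
        metric_triples_subset_path_triples[OF cps pos short unique]
      by (intro exI[of _ "path_dist V P w"]) blast
  next
    assume "metric_path_system V P"
    then obtain w where pos: "positive_weight V w"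
      and short: "\<And>p u v. p \<in> P \<Longrightarrow> simple_path_between V u v p \<Longrightarrow> shortest_path V w u v p"
      by (auto simp: metric_path_system_def)
    show "\<exists>\<rho>. Metric_space V \<rho> \<and> path_triples V P \<subseteq> metric_triples V \<rho>"
      using Metric_space_path_dist[OF cps pos short]
        path_triples_subset_metric_triples[OF cps pos short]
      by blast
  next
    assume "\<exists>\<rho>. Metric_space V \<rho> \<and> path_triples V P = metric_triples V \<rho>"
    then obtain \<rho> where \<rho>: "Metric_space V \<rho>" "path_triples V P \<subseteq> metric_triples V \<rho>"
      "metric_triples V \<rho> \<subseteq> path_triples V P"
      by auto
    then show "strictly_metric_path_system V P"
      unfolding strictly_metric_path_system_def
      using positive_system_weight[OF cps \<rho>(1,2)] system_paths_unique_shortest[OF cps \<rho>]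
      by blast
  next
    assume "\<exists>\<rho>. Metric_space V \<rho> \<and> path_triples V P \<subseteq> metric_triples V \<rho>"
    then obtain \<rho> where \<rho>: "Metric_space V \<rho>" "path_triples V P \<subseteq> metric_triples V \<rho>"
      by auto
    then show "metric_path_system V P"
      unfolding metric_path_system_def
      using positive_system_weight[OF cps \<rho>] system_paths_shortest[OF cps \<rho>]
      by blast
  }
qed

end
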